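(* Let $n,m$ be positive integers with $\mathfrak{B}_{n,m}\neq\emptyset$. Every bipartite optimal graph in $\mathfrak{B}_{n,m}$ is a difference graph.
   Context: All graphs are finite, simple and undirected. For a graph $G$ on $n$ vertices with adjacency matrix $\mathbf{A}(G)$, write $\det(\lambda I-\mathbf{A}(G))=\sum_{i=0}^n \mathbf{a}_i(G)\lambda^{n-i}$, so $\mathbf{a}_4(G)$ is the coefficient of $\lambda^{n-4}$. $\mathfrak{B}_{n,m}$ denotes the set of all connected bipartite graphs with $n$ vertices and $m$ edges. A graph $G\in\mathfrak{B}_{n,m}$ is called bipartite optimal if $\mathbf{a}_4(G)=\min\{\mathbf{a}_4(H): H\in\mathfrak{B}_{n,m}\}$. A graph $G$ is a difference graph if there exist a real $t$ and a function $w:V(G)\to\mathbb{R}$ with $|w(v)|<t$ for all $v$, such that distinct vertices $u,v$ are adjacent if and only if $|w(u)-w(v)|\ge t$ (equivalently, $G$ is bipartite and the neighborhoods of the vertices in one of the partite sets are linearly ordered by inclusion). *)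

theory Defs
  imports
    "Graph_Theory.Pair_Digraph"
    "Graph_Theory.Digraph_Component"
    "Jordan_Normal_Form.Char_Poly"
begin

text \<open>
  A finite simple undirected graph is a \<open>pair_graph\<close>: a finite, loop-free, symmetric relation
  \<open>parcs G\<close> on the vertex set \<open>pverts G\<close>. Every undirected edge \<open>{u, v}\<close> is thus represented by
  the two arcs \<open>(u, v)\<close> and \<open>(v, u)\<close>, and \<open>uedges\<close> counts it once.
\<close>

definition uedges :: "'a pair_pre_digraph \<Rightarrow> 'a set set" where
  "uedges G = {{u, v} | u v. (u, v) \<in> parcs G}"

definition bipartite :: "'a pair_pre_digraph \<Rightarrow> bool" where
  "bipartite G \<longleftrightarrow> (\<exists>X Y. pverts G = X \<union> Y \<and> X \<inter> Y = {} \<and>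
     (\<forall>(u, v) \<in> parcs G. u \<in> X \<and> v \<in> Y \<or> u \<in> Y \<and> v \<in> X))"

definition bip_graphs :: "nat \<Rightarrow> nat \<Rightarrow> 'a pair_pre_digraph set" where
  "bip_graphs n m = {G. pair_graph G \<and> connected (with_proj G) \<and> bipartite G \<and>
     card (pverts G) = n \<and> card (uedges G) = m}"

definition adjacency_matrix :: "'a list \<Rightarrow> 'a pair_pre_digraph \<Rightarrow> real mat" where
  "adjacency_matrix vs G = mat (length vs) (length vs)
     (\<lambda>(i, j). if (vs ! i, vs ! j) \<in> parcs G then 1 else 0)"

text \<open>
  The vertices are put into an arbitrary order to form the matrix; the polynomial does not
  depend on it, see \<open>graph_poly_eq\<close> below.
\<close>

definition graph_poly :: "'a pair_pre_digraph \<Rightarrow> real poly" where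
  "graph_poly G = char_poly (adjacency_matrix (SOME vs. distinct vs \<and> set vs = pverts G) G)"

text \<open>
  The coefficient of \<open>\<lambda>\<^sup>n\<^sup>-\<^sup>i\<close>, where \<open>n\<close> is the number of vertices. For \<open>i > n\<close> there is no such
  coefficient; the value is then \<open>0\<close> (truncated subtraction would give the constant term).
\<close>

definition poly_coeff :: "nat \<Rightarrow> 'a pair_pre_digraph \<Rightarrow> real" where
  "poly_coeff i G =
     (if i \<le> card (pverts G) then coeff (graph_poly G) (card (pverts G) - i) else 0)"

text \<open>
  The competitors \<open>H\<close> have vertices in the same type as \<open>G\<close>. This is no restriction: that type has
  at least \<open>n\<close> elements, so it contains a copy of every graph on \<open>n\<close> vertices.
\<close>

definition bipartite_optimal :: "nat \<Rightarrow> nat \<Rightarrow> 'a pair_pre_digraph \<Rightarrow> bool" where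
  "bipartite_optimal n m G \<longleftrightarrow> G \<in> bip_graphs n m \<and>
     (\<forall>H \<in> (bip_graphs n m :: 'a pair_pre_digraph set). poly_coeff 4 G \<le> poly_coeff 4 H)"

definition difference_graph :: "'a pair_pre_digraph \<Rightarrow> bool" where
  "difference_graph G \<longleftrightarrow> (\<exists>(t::real) (w :: 'a \<Rightarrow> real).
     (\<forall>v \<in> pverts G. \<bar>w v\<bar> < t) \<and>
     (\<forall>u \<in> pverts G. \<forall>v \<in> pverts G. u \<noteq> v \<longrightarrow>
        ((u, v) \<in> parcs G \<longleftrightarrow> \<bar>w u - w v\<bar> \<ge> t)))"

lemma sum_nth_delta:
  fixes f :: "'a \<Rightarrow> 'b :: semiring_1"
  assumes "distinct us" "x \<in> set us"
  shows "(\<Sum>k<length us. (if x = us ! k then 1 else 0) * f (us ! k)) = f x"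
proof -
  have "bij_betw ((!) us) {..<length us} (set us)"
    using assms(1) by (intro bij_betw_nth) auto
  then have "(\<Sum>k<length us. (if x = us ! k then 1 else 0) * f (us ! k))
      = (\<Sum>y\<in>set us. (if x = y then 1 else 0) * f y)"
    by (rule sum.reindex_bij_betw)
  also have "\<dots> = (\<Sum>y\<in>set us. if x = y then f y else 0)"
    by (intro sum.cong) auto
  also have "\<dots> = f x"
    using assms(2) by simp
  finally show ?thesis .
qed

lemma char_poly_adjacency_matrix_cong:
  fixes vs us :: "'a list"
  assumes "distinct vs" "distinct us" "set vs = set us"
  shows "char_poly (adjacency_matrix vs G) = char_poly (adjacency_matrix us G)"
proof -
  define n where "n = length us"
  have lv: "length vs = n"
    unfolding n_def using distinct_card[OF assms(1)] distinct_card[OF assms(2)] assms(3) by simp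
  define P where "P = (\<lambda>(as :: 'a list) bs. mat n n (\<lambda>(i, j). if as ! i = bs ! j then 1 else 0 :: real))"
  have car: "P as bs \<in> carrier_mat n n" for as bs
    by (simp add: P_def)
  have caru: "adjacency_matrix us G \<in> carrier_mat n n" and carv: "adjacency_matrix vs G \<in> carrier_mat n n"
    by (auto simp: adjacency_matrix_def lv n_def)
  have inv: "P as bs * P bs as = 1\<^sub>m n"
    if "distinct as" "distinct bs" "set as = set bs" "length as = n" "length bs = n"
    for as bs :: "'a list"
  proof (rule eq_matI)
    fix i j assume "i < dim_row (1\<^sub>m n :: real mat)" "j < dim_col (1\<^sub>m n :: real mat)"
    then have ij: "i < n" "j < n" by auto
    have "(P as bs * P bs as) $$ (i, j) = (\<Sum>k<length bs.
        (if as ! i = bs ! k then 1 else 0) * (if bs ! k = as ! j then 1 else 0))"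
      using ij that by (simp add: P_def scalar_prod_def lessThan_atLeast0)
    also have "\<dots> = (if as ! i = as ! j then 1 else 0)"
    proof (rule sum_nth_delta[OF that(2), where f = "\<lambda>y. if y = as ! j then 1 else 0"])
      show "as ! i \<in> set bs" unfolding that(3)[symmetric] using ij that(4) by (intro nth_mem) simp
    qed
    also have "\<dots> = 1\<^sub>m n $$ (i, j)"
      using ij that by (simp add: nth_eq_iff_index_eq)
    finally show "(P as bs * P bs as) $$ (i, j) = 1\<^sub>m n $$ (i, j)" .
  qed (auto simp: P_def)
  have "adjacency_matrix vs G = P vs us * adjacency_matrix us G * P us vs"
  proof (rule eq_matI)
    fix i j
    assume "i < dim_row (P vs us * adjacency_matrix us G * P us vs)"
      "j < dim_col (P vs us * adjacency_matrix us G * P us vs)"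
    then have ij: "i < n" "j < n" by (auto simp: P_def)
    have vin: "vs ! i \<in> set us" "vs ! j \<in> set us"
      unfolding assms(3)[symmetric] using ij lv by (auto intro!: nth_mem)
    let ?a = "\<lambda>x y. if (x, y) \<in> parcs G then 1 else 0 :: real"
    have row: "(P vs us * adjacency_matrix us G) $$ (i, k) = ?a (vs ! i) (us ! k)" if "k < n" for k
    proof -
      have "(P vs us * adjacency_matrix us G) $$ (i, k) = (\<Sum>l<length us.
          (if vs ! i = us ! l then 1 else 0) * ?a (us ! l) (us ! k))"
        using ij that by (simp add: P_def adjacency_matrix_def scalar_prod_def lessThan_atLeast0 n_def)
      also have "\<dots> = ?a (vs ! i) (us ! k)"
        by (rule sum_nth_delta[OF assms(2) vin(1)])
      finally show ?thesis .
    qed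
    have "(P vs us * adjacency_matrix us G * P us vs) $$ (i, j)
        = (\<Sum>k<n. (P vs us * adjacency_matrix us G) $$ (i, k) * P us vs $$ (k, j))"
      using ij car caru by (simp add: scalar_prod_def lessThan_atLeast0 P_def adjacency_matrix_def n_def)
    also have "\<dots> = (\<Sum>k<length us. (if vs ! j = us ! k then 1 else 0) * ?a (vs ! i) (us ! k))"
      unfolding n_def[symmetric]
    proof (rule sum.cong)
      fix k assume "k \<in> {..<n}"
      then have k: "k < n" by simp
      have "P us vs $$ (k, j) = (if vs ! j = us ! k then 1 else 0)"
        using ij k by (simp add: P_def)
      then show "(P vs us * adjacency_matrix us G) $$ (i, k) * P us vs $$ (k, j)
          = (if vs ! j = us ! k then 1 else 0) * ?a (vs ! i) (us ! k)"
        by (simp add: row[OF k])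
    qed simp
    also have "\<dots> = ?a (vs ! i) (vs ! j)"
      by (rule sum_nth_delta[OF assms(2) vin(2)])
    also have "\<dots> = adjacency_matrix vs G $$ (i, j)"
      using ij lv by (simp add: adjacency_matrix_def)
    finally show "adjacency_matrix vs G $$ (i, j) = (P vs us * adjacency_matrix us G * P us vs) $$ (i, j)" by simp
  qed (auto simp: P_def adjacency_matrix_def lv)
  then have "similar_mat (adjacency_matrix vs G) (adjacency_matrix us G)"
    using similar_matI[of "adjacency_matrix vs G" "adjacency_matrix us G" "P vs us" "P us vs" n]
      car caru carv inv[OF assms(1,2,3) lv n_def[symmetric]]
      inv[OF assms(2,1) assms(3)[symmetric] n_def[symmetric] lv]
    by blast
  then show ?thesis by (rule char_poly_similar)
qed

lemma graph_poly_eq: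
  assumes "distinct vs" "set vs = pverts G"
  shows "graph_poly G = char_poly (adjacency_matrix vs G)"
proof -
  let ?us = "SOME vs. distinct vs \<and> set vs = pverts G"
  have "distinct ?us \<and> set ?us = pverts G"
    by (rule someI[of _ vs]) (use assms in simp)
  then show ?thesis
    unfolding graph_poly_def using assms by (intro char_poly_adjacency_matrix_cong) auto
qed

end

(*
  Since a_1 = a_3 = 0, Newton's identities give a_4 = tr(A^2)^2/8 - tr(A^4)/4, and tr(A^4) is the sum
  of the squared codegrees over all pairs of vertices, which in a bipartite graph is twice the sum
  over the pairs in one part. If u and v have a common neighbour and incomparable neighbourhoods,
  replace N(u), N(v) by their union and intersection: the graph stays connected and bipartite with
  the same number of edges, while the sum of squared codegrees strictly grows. So in an optimal
  graph any two vertices with a common neighbour have comparable neighbourhoods, and by connectedness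
  this makes all neighbourhoods in one part nested.
*)
theory Submission
  imports Defs "Jordan_Normal_Form.Schur_Decomposition"
begin

section \<open>Traces of matrix powers and triangular matrices\<close>

definition mat_trace :: "'a::comm_monoid_add mat \<Rightarrow> 'a" where
  "mat_trace A = (\<Sum>i<dim_row A. A $$ (i, i))"

lemma mat_trace_mult:
  fixes A B :: "'a::comm_semiring_0 mat"
  assumes "A \<in> carrier_mat n m" "B \<in> carrier_mat m n"
  shows "mat_trace (A * B) = (\<Sum>i<n. \<Sum>k<m. A $$ (i, k) * B $$ (k, i))"
  using assms by (auto simp: mat_trace_def scalar_prod_def lessThan_atLeast0 intro!: sum.cong)

lemma mat_trace_mult_commute:
  fixes A B :: "'a::comm_semiring_0 mat"
  assumes "A \<in> carrier_mat n m" "B \<in> carrier_mat m n"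
  shows "mat_trace (A * B) = mat_trace (B * A)"
  unfolding mat_trace_mult[OF assms] mat_trace_mult[OF assms(2,1)]
  by (subst sum.swap) (simp add: mult.commute)

text \<open>With \<open>A ^\<^sub>m k = P * B ^\<^sub>m k * Q\<close> and \<open>Q * P = 1\<close>,
  cycling the trace cancels the conjugation. This lets traces be read off a triangular form.\<close>

lemma mat_trace_pow_similar:
  fixes A B :: "'a::comm_ring_1 mat"
  assumes "similar_mat A B"
  shows "mat_trace (A ^\<^sub>m k) = mat_trace (B ^\<^sub>m k)"
proof -
  obtain P Q where wit: "similar_mat_wit A B P Q"
    using assms by (auto simp: similar_mat_def)
  define n where "n = dim_row A"
  note D = similar_mat_witD[OF n_def wit]
  have Bk: "B ^\<^sub>m k \<in> carrier_mat n n"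
    using D by simp
  have "mat_trace (A ^\<^sub>m k) = mat_trace (P * (B ^\<^sub>m k * Q))"
    unfolding similar_mat_wit_pow_id[OF wit] using D(5-) Bk
    by (simp add: assoc_mult_mat[of _ n n _ n _ n])
  also have "\<dots> = mat_trace (B ^\<^sub>m k * Q * P)"
    using D Bk by (intro mat_trace_mult_commute[of _ n n]) auto
  also have "B ^\<^sub>m k * Q * P = B ^\<^sub>m k"
    using D Bk by (simp add: assoc_mult_mat[of _ n n _ n _ n])
  finally show ?thesis .
qed

text \<open>For \<open>j \<le> i\<close> the summand \<open>A $$ (i, k) * B $$ (k, j)\<close>
  vanishes by its first factor if \<open>k < i\<close> and by its second if \<open>j < k\<close>;
  only \<open>k = i = j\<close> can survive.\<close>

lemma upper_triangular_mult:
  fixes A B :: "'a::semiring_0 mat"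
  assumes "A \<in> carrier_mat n n" "B \<in> carrier_mat n n" "upper_triangular A" "upper_triangular B"
  shows "upper_triangular (A * B)"
    and "i < n \<Longrightarrow> (A * B) $$ (i, i) = A $$ (i, i) * B $$ (i, i)"
proof -
  have z: "A $$ (i, k) * B $$ (k, j) = 0" if "i < n" "k < n" "j < n" "j \<le> i" "\<not> (k = i \<and> j = i)" for i j k
  proof (cases "k < i")
    case True
    with assms that show ?thesis by (auto simp: upper_triangular_def)
  next
    case False
    with that have "j < k" by auto
    with assms that show ?thesis by (auto simp: upper_triangular_def)
  qed
  have e: "(A * B) $$ (i, j) = (\<Sum>k<n. A $$ (i, k) * B $$ (k, j))" if "i < n" "j < n" for i j
    using assms(1,2) that by (simp add: scalar_prod_def lessThan_atLeast0)
  show "upper_triangular (A * B)"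
    using assms(1,2) z by (auto simp: e upper_triangular_def simp del: index_mult_mat(1) intro!: sum.neutral)
  show "(A * B) $$ (i, i) = A $$ (i, i) * B $$ (i, i)" if "i < n"
  proof -
    have "(A * B) $$ (i, i) = (\<Sum>k<n. if k = i then A $$ (i, i) * B $$ (i, i) else 0)"
      unfolding e[OF that that] using z that by (intro sum.cong) auto
    with that show ?thesis by simp
  qed
qed

lemma upper_triangular_pow:
  fixes A :: "'a::semiring_1 mat"
  assumes "A \<in> carrier_mat n n" "upper_triangular A"
  shows "upper_triangular (A ^\<^sub>m k) \<and> (\<forall>i<n. (A ^\<^sub>m k) $$ (i, i) = A $$ (i, i) ^ k)"
proof (induction k)
  case 0
  then show ?case using assms by (auto simp: upper_triangular_def)
next
  case (Suc k)
  with upper_triangular_mult[of "A ^\<^sub>m k" n A] assms show ?case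
    by (simp add: power_commutes del: index_mult_mat(1))
qed

section \<open>Vieta's formula and Newton's identities\<close>

text \<open>\<open>signed_esym xs k\<close> is \<open>(-1)\<^sup>k\<close> times the \<open>k\<close>-th elementary symmetric polynomial of \<open>xs\<close>.\<close>

fun signed_esym :: "'a::comm_ring_1 list \<Rightarrow> nat \<Rightarrow> 'a" where
  "signed_esym xs 0 = 1"
| "signed_esym [] (Suc k) = 0"
| "signed_esym (x # xs) (Suc k) = signed_esym xs (Suc k) - x * signed_esym xs k"

lemma signed_esym_eq_0: "length xs < k \<Longrightarrow> signed_esym xs k = 0"
  by (induction xs k rule: signed_esym.induct) auto

lemma degree_prod_linear_le:
  "degree (\<Prod>a\<leftarrow>xs. [:- a, 1:] :: 'a::comm_ring_1 poly) \<le> length xs"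
proof (induction xs)
  case (Cons a xs)
  have "degree ([:- a, 1:] * (\<Prod>a\<leftarrow>xs. [:- a, 1:])) \<le> degree [:- a, 1:] + degree (\<Prod>a\<leftarrow>xs. [:- a, 1:])"
    by (rule degree_mult_le)
  with Cons show ?case by simp
qed simp

text \<open>Vieta's formula: multiplying by one more factor \<open>[:- x, 1:]\<close> acts on the
  coefficients exactly as the recursion of \<open>signed_esym\<close>.\<close>

lemma coeff_prod_linear:
  "k \<le> length xs \<Longrightarrow>
    coeff (\<Prod>a\<leftarrow>xs. [:- a, 1:]) (length xs - k) = signed_esym xs k"
proof (induction xs arbitrary: k)
  case (Cons x xs)
  let ?P = "\<Prod>a\<leftarrow>xs. [:- a, 1:]"
  show ?case
  proof (cases k)
    case 0
    have "coeff ?P (Suc (length xs)) = 0"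
      by (rule coeff_eq_0) (use degree_prod_linear_le[of xs] in simp)
    with Cons.IH[of 0] 0 show ?thesis by simp
  next
    case (Suc j)
    show ?thesis
    proof (cases "j = length xs")
      \<comment> \<open>This is the constant term. The hypothesis for \<open>Suc j\<close> is out of
        range here, and \<open>signed_esym xs (Suc j)\<close> vanishes, so only the product with
        \<open>- x\<close> remains.\<close>
      case True
      with Cons.IH[of j] Suc show ?thesis by (simp add: signed_esym_eq_0)
    next
      case False
      with Cons.prems Suc have j: "j < length xs" by simp
      then obtain l where l: "length xs - j = Suc l" "length xs - Suc j = l"
        by (metis Suc_diff_Suc)
      from Cons.IH[of j] Cons.IH[of "Suc j"] j l Suc show ?thesis by simp
    qed
  qed
qed simp

text \<open>Scaling the \<open>k\<close>-th identity by the factorial of \<open>k\<close> avoids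
  division in a general commutative ring. All identities go through one induction, since the step
  for \<open>k\<close> uses the one for \<open>k - 1\<close>.\<close>

lemma newton_identities:
  fixes xs :: "'a::comm_ring_1 list"
  defines "p \<equiv> \<lambda>k. \<Sum>x\<leftarrow>xs. x ^ k"
  shows "signed_esym xs 1 = - p 1"
    and "2 * signed_esym xs 2 = p 1 ^ 2 - p 2"
    and "6 * signed_esym xs 3 = - (p 1 ^ 3) + 3 * p 1 * p 2 - 2 * p 3"
    and "24 * signed_esym xs 4 =
      p 1 ^ 4 - 6 * p 1 ^ 2 * p 2 + 3 * p 2 ^ 2 + 8 * p 1 * p 3 - 6 * p 4"
proof -
  have *: "signed_esym xs 1 = - p 1 \<and>
    2 * signed_esym xs 2 = p 1 ^ 2 - p 2 \<and>
    6 * signed_esym xs 3 = - (p 1 ^ 3) + 3 * p 1 * p 2 - 2 * p 3 \<and>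
    24 * signed_esym xs 4 =
      p 1 ^ 4 - 6 * p 1 ^ 2 * p 2 + 3 * p 2 ^ 2 + 8 * p 1 * p 3 - 6 * p 4"
    unfolding p_def
  proof (induction xs)
    case Nil
    then show ?case by (simp add: numeral_eq_Suc)
  next
    case (Cons x xs)
    let ?e = "signed_esym xs"
    have s: "signed_esym (x # xs) 1 = ?e 1 - x" "signed_esym (x # xs) 2 = ?e 2 - x * ?e 1"
      "signed_esym (x # xs) 3 = ?e 3 - x * ?e 2" "signed_esym (x # xs) 4 = ?e 4 - x * ?e 3"
      by (simp_all add: numeral_eq_Suc)
    define p q r t where d: "p = (\<Sum>x\<leftarrow>xs. x ^ 1)" "q = (\<Sum>x\<leftarrow>xs. x ^ 2)"
      "r = (\<Sum>x\<leftarrow>xs. x ^ 3)" "t = (\<Sum>x\<leftarrow>xs. x ^ 4)"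
    define e2 e3 e4 where e: "e2 = ?e 2" "e3 = ?e 3" "e4 = ?e 4"
    have IH: "?e 1 = - p" "2 * e2 = p ^ 2 - q" "6 * e3 = - (p ^ 3) + 3 * p * q - 2 * r"
      "24 * e4 = p ^ 4 - 6 * p ^ 2 * q + 3 * q ^ 2 + 8 * p * r - 6 * t"
      using Cons.IH unfolding d e by auto
    show ?case
      unfolding s sum_list.Cons list.map d[symmetric] e[symmetric] IH(1)
      unfolding power_one_right
    proof (intro conjI)
      show "- p - x = - (x + p)" by simp
      show "2 * (e2 - x * - p) = (x + p) ^ 2 - (x ^ 2 + q)"
        using IH(2) by (simp add: power2_eq_square algebra_simps)
      show "6 * (e3 - x * e2) = - ((x + p) ^ 3) + 3 * (x + p) * (x ^ 2 + q) - 2 * (x ^ 3 + r)"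
      proof -
        \<comment> \<open>Regrouping into \<open>6 * e3\<close> and \<open>2 * e2\<close> makes the
          induction hypotheses applicable without dividing.\<close>
        have "6 * (e3 - x * e2) = 6 * e3 - 3 * x * (2 * e2)"
          by (simp add: algebra_simps)
        then show ?thesis unfolding IH
          by (simp add: algebra_simps power2_eq_square power3_eq_cube power4_eq_xxxx)
      qed
      show "24 * (e4 - x * e3) = (x + p) ^ 4 - 6 * (x + p) ^ 2 * (x ^ 2 + q) +
          3 * (x ^ 2 + q) ^ 2 + 8 * (x + p) * (x ^ 3 + r) - 6 * (x ^ 4 + t)"
      proof -
        have "24 * (e4 - x * e3) = 24 * e4 - 4 * x * (6 * e3)"
          by (simp add: algebra_simps)
        then show ?thesis unfolding IH
          by (simp add: algebra_simps power2_eq_square power3_eq_cube power4_eq_xxxx)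
      qed
    qed
  qed
  show "signed_esym xs 1 = - p 1"
    "2 * signed_esym xs 2 = p 1 ^ 2 - p 2"
    "6 * signed_esym xs 3 = - (p 1 ^ 3) + 3 * p 1 * p 2 - 2 * p 3"
    "24 * signed_esym xs 4 =
      p 1 ^ 4 - 6 * p 1 ^ 2 * p 2 + 3 * p 2 ^ 2 + 8 * p 1 * p 3 - 6 * p 4"
    using * by auto
qed

section \<open>The coefficient a_4 in terms of traces\<close>

text \<open>Over the complex numbers the characteristic polynomial splits, and Schur's theorem gives
  a similar triangular matrix with the eigenvalues on its diagonal, so power sums are traces of
  powers. As \<open>p 1 = 0\<close>, Newton's fourth identity becomes
  \<open>24 * e4 = 3 * p 2 ^ 2 - 6 * p 4\<close>, which is then divided by 3.\<close>

lemma coeff_4_char_poly_complex: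
  fixes A :: "complex mat"
  assumes A: "A \<in> carrier_mat n n" and n: "4 \<le> n" and tr: "mat_trace A = 0"
  shows "8 * coeff (char_poly A) (n - 4) = mat_trace (A ^\<^sub>m 2) ^ 2 - 2 * mat_trace (A ^\<^sub>m 4)"
proof -
  obtain as where as: "char_poly A = (\<Prod>a\<leftarrow>as. [:- a, 1:])" 
    using char_poly_factorized[OF A] by blast
  obtain B where B: "B \<in> carrier_mat n n" "upper_triangular B" and sim: "similar_mat A B"
    using schur_decomposition_exists[OF A as] by blast
  define es where "es = diag_mat B"
  have len: "length es = n"
    using B by (simp add: es_def diag_mat_def)
  have cp: "char_poly A = (\<Prod>a\<leftarrow>es. [:- a, 1:])"
    unfolding char_poly_similar[OF sim] es_def by (rule char_poly_upper_triangular[OF B])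
  have p: "(\<Sum>x\<leftarrow>es. x ^ k) = mat_trace (A ^\<^sub>m k)" for k
  proof -
    have "(\<Sum>x\<leftarrow>es. x ^ k) = (\<Sum>i<n. (B ^\<^sub>m k) $$ (i, i))"
      using upper_triangular_pow[OF B, of k] B(1)
      by (simp add: es_def diag_mat_def o_def interv_sum_list_conv_sum_set_nat lessThan_atLeast0)
    also have "\<dots> = mat_trace (B ^\<^sub>m k)"
      using B(1) by (simp add: mat_trace_def)
    finally show ?thesis by (simp add: mat_trace_pow_similar[OF sim])
  qed
  have "mat_trace (A ^\<^sub>m 1) = 0"
    using A tr by simp
  with newton_identities(4)[of es]
  have "3 * (8 * signed_esym es 4) = 3 * (mat_trace (A ^\<^sub>m 2) ^ 2 - 2 * mat_trace (A ^\<^sub>m 4))"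
    unfolding p by (simp add: algebra_simps)
  then have "8 * signed_esym es 4 = mat_trace (A ^\<^sub>m 2) ^ 2 - 2 * mat_trace (A ^\<^sub>m 4)"
    by (metis mult_left_cancel zero_neq_numeral)
  then show ?thesis
    using coeff_prod_linear[of 4 es] n len by (simp add: cp)
qed

text \<open>The embedding into the complex numbers is an injective ring homomorphism, so it commutes
  with products, traces and characteristic polynomials and the identity pulls back.\<close>

lemma coeff_4_char_poly_real:
  fixes A :: "real mat"
  assumes A: "A \<in> carrier_mat n n" and n: "4 \<le> n" and tr: "mat_trace A = 0"
  shows "8 * coeff (char_poly A) (n - 4) = mat_trace (A * A) ^ 2 - 2 * mat_trace (A * A * (A * A))"
proof -
  let ?C = "map_mat complex_of_real A"
  have C: "?C \<in> carrier_mat n n" using A by simp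
  have t: "mat_trace (map_mat complex_of_real M) = of_real (mat_trace M)" if "M \<in> carrier_mat n n" for M
    using that by (simp add: mat_trace_def)
  have c2: "?C * ?C = map_mat complex_of_real (A * A)"
    by (rule of_real_hom.mat_hom_mult[OF A A, symmetric])
  have c4: "?C * ?C * (?C * ?C) = map_mat complex_of_real (A * A * (A * A))"
    unfolding c2 by (rule of_real_hom.mat_hom_mult[symmetric]) (use A in auto)
  have pw: "?C ^\<^sub>m 2 = ?C * ?C" "?C ^\<^sub>m 4 = ?C * ?C * (?C * ?C)"
    using C by (simp_all add: numeral_eq_Suc assoc_mult_mat[of _ n n _ n _ n])
  have "8 * coeff (char_poly ?C) (n - 4) = mat_trace (?C ^\<^sub>m 2) ^ 2 - 2 * mat_trace (?C ^\<^sub>m 4)"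
    using C n by (rule coeff_4_char_poly_complex) (simp add: t[OF A] tr)
  also have "char_poly ?C = map_poly complex_of_real (char_poly A)"
    by (rule of_real_hom.char_poly_hom[OF A])
  also have "coeff \<dots> (n - 4) = of_real (coeff (char_poly A) (n - 4))"
    by simp
  finally have "complex_of_real (8 * coeff (char_poly A) (n - 4)) =
    of_real (mat_trace (A * A) ^ 2 - 2 * mat_trace (A * A * (A * A)))"
    unfolding pw c2 c4[unfolded c2] t[OF mult_carrier_mat[OF A A]]
      t[OF mult_carrier_mat[OF mult_carrier_mat[OF A A] mult_carrier_mat[OF A A]]]
    by simp
  then show ?thesis by (rule of_real_eq_iff[THEN iffD1])
qed

section \<open>Neighbourhoods, connectedness and a_4 of a graph\<close>

definition nbrs :: "'a pair_pre_digraph \<Rightarrow> 'a \<Rightarrow> 'a set" where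
  "nbrs G v = {w. (v, w) \<in> parcs G}"

lemma nbrs_iff: "w \<in> nbrs G v \<longleftrightarrow> (v, w) \<in> parcs G"
  by (simp add: nbrs_def)

context pair_graph
begin

lemma nbrs_sym: "w \<in> nbrs G v \<longleftrightarrow> v \<in> nbrs G w"
  using pair_sym_arcs by (auto simp: nbrs_iff symmetric_def dest: symD)

lemma nbrs_subset: "nbrs G v \<subseteq> pverts G"
  by (auto simp: nbrs_iff dest: wellformed')

lemma finite_nbrs: "finite (nbrs G v)"
  using nbrs_subset pair_finite_verts by (rule finite_subset)

text \<open>\<open>connected\<close> means strong connectedness of the symmetric closure, and here
  the arcs are already symmetric. Reachability also demands vertices, which matters only for the
  empty walk.\<close>

lemma connected_iff_rtrancl:
  "connected (with_proj G) \<longleftrightarrow>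
    pverts G \<noteq> {} \<and> (\<forall>u\<in>pverts G. \<forall>v\<in>pverts G. (u, v) \<in> (parcs G)\<^sup>*)"
proof -
  have "reachable (with_proj (mk_symmetric (with_proj G))) u v \<longleftrightarrow> (u, v) \<in> (parcs G)\<^sup>*"
    if "u \<in> pverts G" for u v
  proof -
    have "reachable (with_proj (mk_symmetric (with_proj G))) u v \<longleftrightarrow> reachable (with_proj G) u v"
      by (rule reachable_mk_symmetric_eq[OF pair_sym_arcs])
    also have "\<dots> \<longleftrightarrow> (u, v) \<in> (parcs G)\<^sup>*"
    proof
      show "(u, v) \<in> (parcs G)\<^sup>*" if "reachable (with_proj G) u v"
        using reachable_rtranclI[OF that] by simp
      show "reachable (with_proj G) u v" if "(u, v) \<in> (parcs G)\<^sup>*"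
        using that
      proof induction
        case base
        show ?case using \<open>u \<in> pverts G\<close> by simp
      next
        case (step y z)
        then show ?case by (metis reachable_adj_trans with_proj_simps(3))
      qed
    qed
    finally show ?thesis .
  qed
  then show ?thesis
    unfolding connected_def strongly_connected_def by simp
qed

text \<open>The entries of the squared adjacency matrix are codegrees. Its trace is therefore the
  degree sum, and the trace of its own square is the sum of squared codegrees over ordered
  pairs.\<close>

lemma poly_coeff_4:
  assumes "4 \<le> card (pverts G)"
  shows "8 * poly_coeff 4 G = real (\<Sum>u\<in>pverts G. card (nbrs G u)) ^ 2
    - 2 * real (\<Sum>u\<in>pverts G. \<Sum>v\<in>pverts G. card (nbrs G u \<inter> nbrs G v) ^ 2)"
proof -
  obtain vs where vs: "distinct vs" "set vs = pverts G"
    using finite_distinct_list[OF pair_finite_verts] by blast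
  define n where "n = length vs"
  have n: "n = card (pverts G)"
    using distinct_card[OF vs(1)] vs(2) by (simp add: n_def)
  let ?A = "adjacency_matrix vs G"
  have A: "?A \<in> carrier_mat n n"
    by (simp add: adjacency_matrix_def n_def)
  have reindex: "(\<Sum>i<n. f (vs ! i)) = sum f (pverts G)" for f :: "'a \<Rightarrow> real"
    using sum.reindex_bij_betw[OF bij_betw_nth[OF vs(1) refl refl], of f] vs(2) by (simp add: n_def)
  have count: "(\<Sum>w\<in>pverts G. if w \<in> S then 1 else 0) = real (card (pverts G \<inter> S))" for S
    using pair_finite_verts by (simp add: sum.If_cases)
  have AA: "(?A * ?A) $$ (i, j) = real (card (nbrs G (vs ! i) \<inter> nbrs G (vs ! j)))" if "i < n" "j < n" for i j
  proof -
    have "(?A * ?A) $$ (i, j) = (\<Sum>k<n. if vs ! k \<in> nbrs G (vs ! i) \<inter> nbrs G (vs ! j) then 1 else 0)"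
      using that A nbrs_sym[of "vs ! j"]
      by (auto simp: scalar_prod_def lessThan_atLeast0 adjacency_matrix_def n_def nbrs_iff intro!: sum.cong)
    also have "\<dots> = (\<Sum>w\<in>pverts G. if w \<in> nbrs G (vs ! i) \<inter> nbrs G (vs ! j) then 1 else 0)"
      by (rule reindex)
    also have "\<dots> = real (card (pverts G \<inter> (nbrs G (vs ! i) \<inter> nbrs G (vs ! j))))"
      by (rule count)
    also have "pverts G \<inter> (nbrs G (vs ! i) \<inter> nbrs G (vs ! j)) = nbrs G (vs ! i) \<inter> nbrs G (vs ! j)"
      using nbrs_subset by blast
    finally show ?thesis .
  qed
  have AA_car: "?A * ?A \<in> carrier_mat n n"
    using A by simp
  have "mat_trace ?A = 0"
    using pair_no_loops by (force simp: mat_trace_def adjacency_matrix_def intro!: sum.neutral)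
  moreover have "mat_trace (?A * ?A) = real (\<Sum>u\<in>pverts G. card (nbrs G u))"
  proof -
    have "mat_trace (?A * ?A) = (\<Sum>i<n. real (card (nbrs G (vs ! i))))"
      unfolding mat_trace_def using A AA by (intro sum.cong) auto
    then show ?thesis by (simp add: reindex[of "\<lambda>u. real (card (nbrs G u))"])
  qed
  moreover have "mat_trace (?A * ?A * (?A * ?A)) =
    real (\<Sum>u\<in>pverts G. \<Sum>v\<in>pverts G. card (nbrs G u \<inter> nbrs G v) ^ 2)"
  proof -
    let ?c = "\<lambda>u v. real (card (nbrs G u \<inter> nbrs G v))"
    have "mat_trace (?A * ?A * (?A * ?A)) = (\<Sum>i<n. \<Sum>j<n. (?A * ?A) $$ (i, j) * (?A * ?A) $$ (j, i))"
      by (rule mat_trace_mult[OF AA_car AA_car])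
    also have "\<dots> = (\<Sum>i<n. \<Sum>j<n. ?c (vs ! i) (vs ! j) ^ 2)"
      by (intro sum.cong refl) (simp add: AA Int_commute power2_eq_square del: index_mult_mat(1))
    also have "\<dots> = (\<Sum>i<n. \<Sum>v\<in>pverts G. ?c (vs ! i) v ^ 2)"
      by (intro sum.cong refl reindex)
    also have "\<dots> = (\<Sum>u\<in>pverts G. \<Sum>v\<in>pverts G. ?c u v ^ 2)"
      by (rule reindex)
    finally show ?thesis by simp
  qed
  ultimately show ?thesis
    using coeff_4_char_poly_real[OF A] assms n graph_poly_eq[OF vs] by (simp add: poly_coeff_def)
qed

end

section \<open>Counting in bipartite graphs\<close>

text \<open>Makes the two parts explicit that \<open>bipartite\<close> quantifies away, so that a
  result can be applied to either part.\<close>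

definition bipartition :: "'a pair_pre_digraph \<Rightarrow> 'a set \<Rightarrow> 'a set \<Rightarrow> bool" where
  "bipartition G X Y \<longleftrightarrow> pverts G = X \<union> Y \<and> X \<inter> Y = {} \<and>
     (\<forall>(u, v) \<in> parcs G. u \<in> X \<and> v \<in> Y \<or> u \<in> Y \<and> v \<in> X)"

lemma bipartition_commute: "bipartition G X Y \<Longrightarrow> bipartition G Y X"
  by (auto simp: bipartition_def)

lemma bipartition_arc:
  assumes "bipartition G X Y" "(u, v) \<in> parcs G"
  shows "u \<in> X \<and> v \<in> Y \<or> u \<in> Y \<and> v \<in> X"
  using assms by (auto simp: bipartition_def)

lemma bipartition_disjoint: "bipartition G X Y \<Longrightarrow> x \<in> X \<Longrightarrow> x \<in> Y \<Longrightarrow> False"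
  by (auto simp: bipartition_def)

lemma bipartition_nbrs:
  assumes "bipartition G X Y"
  shows "x \<in> X \<Longrightarrow> nbrs G x \<subseteq> Y" "y \<in> Y \<Longrightarrow> nbrs G y \<subseteq> X"
  unfolding nbrs_def using bipartition_arc[OF assms] bipartition_disjoint[OF assms] by blast+

text \<open>Both sides count the quadruples \<open>(x, x', y, y')\<close> that span a closed walk \<open>x y x' y'\<close>.\<close>

lemma sum_codegree_swap:
  fixes e :: "'a \<Rightarrow> 'b \<Rightarrow> 'c::comm_semiring_1"
  shows "(\<Sum>x\<in>X. \<Sum>x'\<in>X. (\<Sum>y\<in>Y. e x y * e x' y) ^ 2) =
    (\<Sum>y\<in>Y. \<Sum>y'\<in>Y. (\<Sum>x\<in>X. e x y * e x y') ^ 2)"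
proof -
  have "(\<Sum>x\<in>X. \<Sum>x'\<in>X. (\<Sum>y\<in>Y. e x y * e x' y) ^ 2) =
    (\<Sum>(x, x')\<in>X \<times> X. \<Sum>(y, y')\<in>Y \<times> Y. (e x y * e x' y) * (e x y' * e x' y'))"
    by (simp add: power2_eq_square sum_product sum.cartesian_product[symmetric])
  also have "\<dots> = (\<Sum>(y, y')\<in>Y \<times> Y. \<Sum>(x, x')\<in>X \<times> X. (e x y * e x y') * (e x' y * e x' y'))"
    unfolding case_prod_unfold by (subst sum.swap) (simp add: ac_simps)
  also have "\<dots> = (\<Sum>y\<in>Y. \<Sum>y'\<in>Y. (\<Sum>x\<in>X. e x y * e x y') ^ 2)"
    by (simp add: power2_eq_square sum_product sum.cartesian_product[symmetric])
  finally show ?thesis .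
qed

lemma card_eq_sum_of_bool:
  assumes "finite Y" "A \<subseteq> Y"
  shows "card A = (\<Sum>y\<in>Y. of_bool (y \<in> A))"
  using assms by (simp add: of_bool_def sum.If_cases Int_absorb1)

context pair_graph
begin

lemma bipartition_finite:
  assumes "bipartition G X Y"
  shows "finite X" "finite Y"
  using pair_finite_verts assms unfolding bipartition_def by (metis finite_Un)+

lemma sum_degree_bipartition:
  assumes bip: "bipartition G X Y"
  shows "(\<Sum>u\<in>pverts G. card (nbrs G u)) = 2 * (\<Sum>x\<in>X. card (nbrs G x))"
proof -
  note fin = bipartition_finite[OF bip]
  have V: "pverts G = X \<union> Y" "X \<inter> Y = {}"
    using bip by (auto simp: bipartition_def)
  have "(\<Sum>y\<in>Y. card (nbrs G y)) = (\<Sum>y\<in>Y. \<Sum>x\<in>X. of_bool (x \<in> nbrs G y))"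
    using bipartition_nbrs(2)[OF bip] fin by (intro sum.cong refl card_eq_sum_of_bool) auto
  also have "\<dots> = (\<Sum>x\<in>X. \<Sum>y\<in>Y. of_bool (y \<in> nbrs G x))"
    by (subst sum.swap) (simp add: nbrs_sym)
  also have "\<dots> = (\<Sum>x\<in>X. card (nbrs G x))"
    using bipartition_nbrs(1)[OF bip] fin by (intro sum.cong refl card_eq_sum_of_bool[symmetric]) auto
  finally show ?thesis
    using fin V by (simp add: sum.union_disjoint)
qed

text \<open>Vertices in different parts have no common neighbour, and by
  \<open>sum_codegree_swap\<close> the two parts contribute equally.\<close>

lemma sum_codegree_bipartition:
  assumes bip: "bipartition G X Y"
  shows "(\<Sum>u\<in>pverts G. \<Sum>v\<in>pverts G. card (nbrs G u \<inter> nbrs G v) ^ 2) =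
    2 * (\<Sum>x\<in>X. \<Sum>x'\<in>X. card (nbrs G x \<inter> nbrs G x') ^ 2)"
proof -
  note fin = bipartition_finite[OF bip]
  note nb = bipartition_nbrs[OF bip]
  have V: "pverts G = X \<union> Y" "X \<inter> Y = {}"
    using bip by (auto simp: bipartition_def)
  let ?c = "\<lambda>u v. card (nbrs G u \<inter> nbrs G v) ^ 2"
  let ?e = "\<lambda>x y. of_bool (y \<in> nbrs G x) :: nat"
  have cross: "?c x y = 0" "?c y x = 0" if "x \<in> X" "y \<in> Y" for x y
    using nb that V(2) by (metis (no_types) card.empty disjoint_iff power_zero_numeral subsetD)+
  have cX: "card (nbrs G x \<inter> nbrs G x') = (\<Sum>y\<in>Y. ?e x y * ?e x' y)" if "x \<in> X" "x' \<in> X" for x x'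
    using card_eq_sum_of_bool[of Y "nbrs G x \<inter> nbrs G x'"] nb(1)[OF that(1)] fin
    by (simp add: of_bool_conj le_infI1)
  have cY: "card (nbrs G y \<inter> nbrs G y') = (\<Sum>x\<in>X. ?e x y * ?e x y')" if "y \<in> Y" "y' \<in> Y" for y y'
    using card_eq_sum_of_bool[of X "nbrs G y \<inter> nbrs G y'"] nb(2)[OF that(1)] fin
    by (simp add: of_bool_conj le_infI1 nbrs_sym[of _ y] nbrs_sym[of _ y'])
  have "(\<Sum>u\<in>pverts G. \<Sum>v\<in>pverts G. ?c u v) = (\<Sum>x\<in>X. \<Sum>x'\<in>X. ?c x x') + (\<Sum>y\<in>Y. \<Sum>y'\<in>Y. ?c y y')"
    using fin V cross by (simp add: sum.union_disjoint)
  also have "(\<Sum>y\<in>Y. \<Sum>y'\<in>Y. ?c y y') = (\<Sum>x\<in>X. \<Sum>x'\<in>X. ?c x x')"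
    using sum_codegree_swap[of ?e Y X] by (simp add: cX cY)
  finally show ?thesis by simp
qed

text \<open>Every edge has exactly one end in \<open>X\<close>, so edges correspond to pairs of a
  vertex in \<open>X\<close> and one of its neighbours.\<close>

lemma card_uedges_bipartition:
  assumes bip: "bipartition G X Y"
  shows "card (uedges G) = (\<Sum>x\<in>X. card (nbrs G x))"
proof -
  have "uedges G = (\<lambda>(x, y). {x, y}) ` Sigma X (nbrs G)"
  proof (intro equalityI subsetI)
    fix e assume "e \<in> uedges G"
    then obtain u v where e: "e = {u, v}" "(u, v) \<in> parcs G"
      by (auto simp: uedges_def)
    then have "(u, v) \<in> Sigma X (nbrs G) \<or> (v, u) \<in> Sigma X (nbrs G)"
      using bipartition_arc[OF bip e(2)] nbrs_sym[of u v] by (auto simp: nbrs_iff)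
    then show "e \<in> (\<lambda>(x, y). {x, y}) ` Sigma X (nbrs G)"
      unfolding e(1) by (metis (no_types, lifting) case_prod_conv image_eqI insert_commute)
  next
    fix e assume "e \<in> (\<lambda>(x, y). {x, y}) ` Sigma X (nbrs G)"
    then obtain x y where "e = {x, y}" "(x, y) \<in> parcs G"
      by (auto simp: nbrs_iff)
    then show "e \<in> uedges G" unfolding uedges_def by blast
  qed
  moreover have "inj_on (\<lambda>(x, y). {x, y}) (Sigma X (nbrs G))"
    using bipartition_nbrs(1)[OF bip] bip
    by (fastforce simp: inj_on_def doubleton_eq_iff bipartition_def)
  ultimately have "card (uedges G) = card (Sigma X (nbrs G))"
    by (simp add: card_image)
  then show ?thesis
    using bipartition_finite[OF bip] finite_nbrs by simp
qed

end

section \<open>Compression of two neighbourhoods\<close>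

text \<open>The right side exceeds the left by \<open>2 * card (A - B) * card (B - A)\<close>, which
  is positive for incomparable sets.\<close>

lemma card_squares_le:
  assumes "finite A" "finite B"
  shows "card A ^ 2 + card B ^ 2 \<le> card (A \<union> B) ^ 2 + card (A \<inter> B) ^ 2"
    and "\<not> A \<subseteq> B \<Longrightarrow> \<not> B \<subseteq> A \<Longrightarrow>
      card A ^ 2 + card B ^ 2 < card (A \<union> B) ^ 2 + card (A \<inter> B) ^ 2"
proof -
  define i a b where "i = card (A \<inter> B)" "a = card (A - B)" "b = card (B - A)"
  have "card A = i + a" "card B = i + b"
    using assms by (simp_all add: i_a_b_def card_Diff_subset_Int Int_commute card_mono)
  moreover have "card (A \<union> B) = i + a + b"
    using card_Un_Int[OF assms] calculation by (simp add: i_a_b_def(1))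
  ultimately have *: "card (A \<union> B) ^ 2 + card (A \<inter> B) ^ 2 = card A ^ 2 + card B ^ 2 + 2 * a * b"
    unfolding i_a_b_def(1)[symmetric] by (simp add: power2_eq_square algebra_simps)
  show "card A ^ 2 + card B ^ 2 \<le> card (A \<union> B) ^ 2 + card (A \<inter> B) ^ 2"
    unfolding * by simp
  show "card A ^ 2 + card B ^ 2 < card (A \<union> B) ^ 2 + card (A \<inter> B) ^ 2" if "\<not> A \<subseteq> B" "\<not> B \<subseteq> A"
    unfolding * using that assms by (auto simp: i_a_b_def card_gt_0_iff)
qed

lemma sum_remove2:
  fixes f :: "'a \<Rightarrow> 'b::comm_monoid_add"
  assumes "finite X" "u \<in> X" "v \<in> X" "u \<noteq> v"
  shows "sum f X = f u + f v + sum f (X - {u, v})"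
proof -
  have "X = insert u (insert v (X - {u, v}))" using assms by blast
  with assms show ?thesis by (metis (no_types, lifting) Diff_iff add.assoc finite_Diff finite_insert insertE insert_iff sum.insert singletonD)
qed

text \<open>The pairs are split by how they meet \<open>{u, v}\<close>. The diagonal terms at
  \<open>u\<close> and \<open>v\<close> grow strictly and the pair \<open>u\<close>,
  \<open>v\<close> is unchanged. For any other \<open>r\<close>, the sets
  \<open>N u \<inter> N r\<close> and \<open>N v \<inter> N r\<close> are replaced by their union
  and intersection, so these terms cannot drop. Pairs avoiding \<open>u\<close> and \<open>v\<close>
  stay the same.\<close>

lemma sum_codegree_compress_less:
  assumes X: "finite X" "u \<in> X" "v \<in> X" and fin: "\<And>x. x \<in> X \<Longrightarrow> finite (N x)"
    and inc: "\<not> N u \<subseteq> N v" "\<not> N v \<subseteq> N u"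
    and N': "N' u = N u \<union> N v" "N' v = N u \<inter> N v" "\<And>x. x \<in> X - {u, v} \<Longrightarrow> N' x = N x"
  shows "(\<Sum>p\<in>X. \<Sum>q\<in>X. card (N p \<inter> N q) ^ 2) < (\<Sum>p\<in>X. \<Sum>q\<in>X. card (N' p \<inter> N' q) ^ 2)"
proof -
  let ?R = "X - {u, v}"
  have "u \<noteq> v" using inc by auto
  note split = sum_remove2[OF X this]
  let ?c = "\<lambda>M p q. card (M p \<inter> M q) ^ 2"
  have expand: "(\<Sum>p\<in>X. \<Sum>q\<in>X. ?c M p q) = (?c M u u + ?c M v v) + 2 * ?c M u v
      + 2 * (\<Sum>r\<in>?R. ?c M u r + ?c M v r) + (\<Sum>r\<in>?R. \<Sum>q\<in>?R. ?c M r q)" for M :: "'a \<Rightarrow> 'b set"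
    unfolding split by (simp add: sum.distrib Int_commute algebra_simps)
  have "?c N u u + ?c N v v < ?c N' u u + ?c N' v v"
    using card_squares_le(2)[OF fin[OF X(2)] fin[OF X(3)] inc] by (simp add: N')
  moreover have "?c N u v = ?c N' u v"
  proof -
    have "(N u \<union> N v) \<inter> (N u \<inter> N v) = N u \<inter> N v" by blast
    then show ?thesis by (simp add: N')
  qed
  moreover have "(\<Sum>r\<in>?R. ?c N u r + ?c N v r) \<le> (\<Sum>r\<in>?R. ?c N' u r + ?c N' v r)"
  proof (rule sum_mono)
    fix r assume "r \<in> ?R"
    with card_squares_le(1)[of "N u \<inter> N r" "N v \<inter> N r"] fin X
    moreover have "N u \<inter> N r \<union> N v \<inter> N r = (N u \<union> N v) \<inter> N r"
      "N u \<inter> N r \<inter> (N v \<inter> N r) = N u \<inter> N v \<inter> N r" by blast+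
    ultimately show "?c N u r + ?c N v r \<le> ?c N' u r + ?c N' v r"
      using \<open>r \<in> ?R\<close> by (simp add: N')
  qed
  moreover have "(\<Sum>r\<in>?R. \<Sum>q\<in>?R. ?c N r q) = (\<Sum>r\<in>?R. \<Sum>q\<in>?R. ?c N' r q)"
    by (simp add: N')
  ultimately show ?thesis
    unfolding expand by linarith
qed

text \<open>The private neighbours of \<open>v\<close> are handed over to \<open>u\<close>, with
  both directions of each arc moved so that the relation stays symmetric.\<close>

definition compress :: "'a \<Rightarrow> 'a \<Rightarrow> 'a pair_pre_digraph \<Rightarrow> 'a pair_pre_digraph" where
  "compress u v G = (let D = nbrs G v - nbrs G u in
     \<lparr> pverts = pverts G,
       parcs = parcs G - ({v} \<times> D \<union> D \<times> {v}) \<union> ({u} \<times> D \<union> D \<times> {u}) \<rparr>)"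

lemma arc_compress_iff:
  "(a, b) \<in> parcs (compress u v G) \<longleftrightarrow>
    (a, b) \<in> parcs G \<and> \<not> (a = v \<and> b \<in> nbrs G v - nbrs G u) \<and> \<not> (b = v \<and> a \<in> nbrs G v - nbrs G u)
    \<or> a = u \<and> b \<in> nbrs G v - nbrs G u \<or> b = u \<and> a \<in> nbrs G v - nbrs G u"
  by (auto simp: compress_def Let_def)

lemma pverts_compress [simp]: "pverts (compress u v G) = pverts G"
  by (simp add: compress_def Let_def)

context pair_graph
begin

context
  fixes X Y u v
  assumes bip: "bipartition G X Y" and uv: "u \<in> X" "v \<in> X"
begin

lemma nbrs_compress:
  assumes "u \<noteq> v"
  shows "nbrs (compress u v G) u = nbrs G u \<union> nbrs G v"
    "nbrs (compress u v G) v = nbrs G u \<inter> nbrs G v"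
    "x \<in> X - {u, v} \<Longrightarrow> nbrs (compress u v G) x = nbrs G x"
proof -
  \<comment> \<open>Neighbours of \<open>v\<close> lie in \<open>Y\<close>, so neither
    \<open>u\<close> nor \<open>v\<close> is among the moved vertices and the two arc directions do
    not interfere.\<close>
  have "u \<notin> nbrs G v" "v \<notin> nbrs G v"
    using bipartition_nbrs(1)[OF bip uv(2)] bipartition_disjoint[OF bip] uv by blast+
  then show "nbrs (compress u v G) u = nbrs G u \<union> nbrs G v"
    "nbrs (compress u v G) v = nbrs G u \<inter> nbrs G v"
    using assms by (auto simp: nbrs_iff arc_compress_iff)
  assume x: "x \<in> X - {u, v}"
  then have "x \<notin> nbrs G v"
    using bipartition_nbrs(1)[OF bip uv(2)] bipartition_disjoint[OF bip] by blast
  with x show "nbrs (compress u v G) x = nbrs G x"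
    by (auto simp: nbrs_iff arc_compress_iff)
qed

lemma bipartition_compress: "bipartition (compress u v G) X Y"
proof -
  have "nbrs G v - nbrs G u \<subseteq> Y" using bipartition_nbrs(1)[OF bip uv(2)] by blast
  then have "a \<in> X \<and> b \<in> Y \<or> a \<in> Y \<and> b \<in> X" if "(a, b) \<in> parcs (compress u v G)" for a b
    using that bipartition_arc[OF bip, of a b] uv unfolding arc_compress_iff by blast
  then show ?thesis
    using bip unfolding bipartition_def by auto
qed

lemma pair_graph_compress: "pair_graph (compress u v G)"
proof -
  have V: "pverts G = X \<union> Y" "X \<inter> Y = {}"
    using bip by (auto simp: bipartition_def)
  have sym: "(a, b) \<in> parcs G \<longleftrightarrow> (b, a) \<in> parcs G" for a b
    using nbrs_sym[of b a] by (simp add: nbrs_iff)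
  show ?thesis
  proof unfold_locales
    show "symmetric (with_proj (compress u v G))"
      using sym by (auto simp: symmetric_def arc_compress_iff intro!: symI)
  next
    fix e assume "e \<in> parcs (compress u v G)"
    then have *: "fst e \<in> X \<and> snd e \<in> Y \<or> fst e \<in> Y \<and> snd e \<in> X"
      by (intro bipartition_arc[OF bipartition_compress]) simp
    then show "fst e \<noteq> snd e"
      using V(2) by auto
    from * show "fst e \<in> pverts (compress u v G)" "snd e \<in> pverts (compress u v G)"
      using V(1) by auto
  qed (use pair_finite_verts pair_finite_arcs finite_nbrs in \<open>auto simp: compress_def Let_def\<close>)
qed

text \<open>The common neighbour \<open>y\<close> keeps its edges to \<open>u\<close> and
  \<open>v\<close>, so each lost edge from \<open>v\<close> to a moved vertex \<open>d\<close> is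
  replaced by the walk \<open>v\<close>, \<open>y\<close>, \<open>u\<close>,
  \<open>d\<close>.\<close>

lemma connected_compress:
  assumes "connected (with_proj G)" and y: "y \<in> nbrs G u \<inter> nbrs G v"
  shows "connected (with_proj (compress u v G))"
proof -
  interpret H: pair_graph "compress u v G" by (rule pair_graph_compress)
  let ?H = "parcs (compress u v G)"
  have sym: "(a, b) \<in> ?H \<Longrightarrow> (b, a) \<in> ?H" for a b
    using H.nbrs_sym[of b a] by (simp add: nbrs_iff)
  have "y \<noteq> u" "y \<noteq> v"
    using y uv bipartition_nbrs(1)[OF bip uv(1)] bipartition_disjoint[OF bip] by blast+
  then have vy: "(v, y) \<in> ?H" and yu: "(y, u) \<in> ?H"
    using y nbrs_sym[of y u] by (auto simp: arc_compress_iff nbrs_iff)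
  have "parcs G \<subseteq> ?H\<^sup>*"
  proof clarify
    fix a b assume ab: "(a, b) \<in> parcs G"
    show "(a, b) \<in> ?H\<^sup>*"
    proof (cases "(a, b) \<in> ?H")
      case False
      then obtain d where d: "(u, d) \<in> ?H" and "a = v \<and> b = d \<or> a = d \<and> b = v"
        using ab unfolding arc_compress_iff by blast
      moreover have "(v, d) \<in> ?H\<^sup>*" "(d, v) \<in> ?H\<^sup>*"
        using vy yu d sym by (meson r_into_rtrancl rtrancl.rtrancl_into_rtrancl)+
      ultimately show ?thesis by blast
    qed blast
  qed
  then have "(parcs G)\<^sup>* \<subseteq> ?H\<^sup>*"
    by (rule rtrancl_subset_rtrancl)
  with assms(1) show ?thesis
    unfolding connected_iff_rtrancl H.connected_iff_rtrancl by auto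
qed

lemma card_uedges_compress:
  assumes "u \<noteq> v"
  shows "card (uedges (compress u v G)) = card (uedges G)"
proof -
  interpret H: pair_graph "compress u v G" by (rule pair_graph_compress)
  have "card (nbrs G u \<union> nbrs G v) + card (nbrs G u \<inter> nbrs G v) = card (nbrs G u) + card (nbrs G v)"
    by (rule card_Un_Int[symmetric]) (rule finite_nbrs)+
  then show ?thesis
    unfolding H.card_uedges_bipartition[OF bipartition_compress] card_uedges_bipartition[OF bip]
      sum_remove2[OF bipartition_finite(1)[OF bip] uv assms]
    by (simp add: nbrs_compress[OF assms])
qed

lemma poly_coeff_compress_less:
  assumes "\<not> nbrs G u \<subseteq> nbrs G v" "\<not> nbrs G v \<subseteq> nbrs G u"
  shows "poly_coeff 4 (compress u v G) < poly_coeff 4 G"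
proof -
  interpret H: pair_graph "compress u v G" by (rule pair_graph_compress)
  have "u \<noteq> v" using assms by auto
  \<comment> \<open>Private neighbours \<open>p\<close> and \<open>q\<close> give, with
    \<open>u\<close> and \<open>v\<close>, the four vertices that the formula for a_4
    requires.\<close>
  obtain p q where pq: "p \<in> nbrs G u" "p \<notin> nbrs G v" "q \<in> nbrs G v" "q \<notin> nbrs G u"
    using assms by blast
  then have "p \<in> Y" "q \<in> Y" "p \<noteq> q"
    using bipartition_nbrs(1)[OF bip] uv by blast+
  then have "card {u, v, p, q} = 4" "{u, v, p, q} \<subseteq> pverts G"
    using bip uv \<open>u \<noteq> v\<close> by (auto simp: bipartition_def card_insert_if)
  then have four: "4 \<le> card (pverts G)"
    using card_mono[OF pair_finite_verts] by metis
  \<comment> \<open>The edge count fixes the degree sum, so only the squared codegrees, which enter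
    with a negative sign, can change a_4.\<close>
  have deg: "(\<Sum>x\<in>X. card (nbrs (compress u v G) x)) = (\<Sum>x\<in>X. card (nbrs G x))"
    using card_uedges_compress[OF \<open>u \<noteq> v\<close>]
    unfolding H.card_uedges_bipartition[OF bipartition_compress] card_uedges_bipartition[OF bip] .
  have "(\<Sum>p\<in>X. \<Sum>q\<in>X. card (nbrs G p \<inter> nbrs G q) ^ 2) <
    (\<Sum>p\<in>X. \<Sum>q\<in>X. card (nbrs (compress u v G) p \<inter> nbrs (compress u v G) q) ^ 2)"
    using bipartition_finite(1)[OF bip] uv finite_nbrs assms nbrs_compress[OF \<open>u \<noteq> v\<close>]
    by (rule sum_codegree_compress_less)
  then have "8 * poly_coeff 4 (compress u v G) < 8 * poly_coeff 4 G"
    using poly_coeff_4[OF four] H.poly_coeff_4 four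
    unfolding H.sum_degree_bipartition[OF bipartition_compress] sum_degree_bipartition[OF bip]
      H.sum_codegree_bipartition[OF bipartition_compress] sum_codegree_bipartition[OF bip] deg
    by (simp del: of_nat_sum)
  then show ?thesis by simp
qed

end

section \<open>From comparable neighbourhoods to difference graphs\<close>

text \<open>
  Along a walk from \<open>u\<close> a common neighbour with \<open>u\<close> is never lost: a path \<open>u y x w w'\<close> forces the
  neighbourhoods of \<open>y\<close> and \<open>w\<close> to be comparable, which gives \<open>u\<close> and \<open>w'\<close> a common neighbour.
\<close>

lemma nested_nbrs:
  assumes bip: "bipartition G X Y" and conn: "connected (with_proj G)"
    and nested: "\<And>a b. nbrs G a \<inter> nbrs G b \<noteq> {} \<Longrightarrow> nbrs G a \<subseteq> nbrs G b \<or> nbrs G b \<subseteq> nbrs G a"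
    and "u \<in> X" "v \<in> X"
  shows "nbrs G u \<subseteq> nbrs G v \<or> nbrs G v \<subseteq> nbrs G u"
proof (cases "nbrs G u = {}")
  case False
  have "(u, v) \<in> (parcs G)\<^sup>*"
    using conn assms(4,5) bip unfolding connected_iff_rtrancl by (auto simp: bipartition_def)
  \<comment> \<open>Invariant along the walk: the first alternative is meant for vertices on the
    side of \<open>u\<close>, the second for those on the other side.\<close>
  then have "nbrs G u \<inter> nbrs G v \<noteq> {} \<or> (\<exists>x \<in> nbrs G v. nbrs G u \<inter> nbrs G x \<noteq> {})"
  proof induction
    case base
    with False show ?case by simp
  next
    case (step w w')
    then have ww': "w \<in> nbrs G w'" "w' \<in> nbrs G w"
      using nbrs_sym[of w w'] by (auto simp: nbrs_iff)
    from step.IH show ?case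
    proof
      assume "\<exists>x \<in> nbrs G w. nbrs G u \<inter> nbrs G x \<noteq> {}"
      then obtain x y where "x \<in> nbrs G w" "y \<in> nbrs G u" "x \<in> nbrs G y"
        using nbrs_sym by blast
      with nested[of y w] have "nbrs G y \<subseteq> nbrs G w \<or> nbrs G w \<subseteq> nbrs G y" by blast
      \<comment> \<open>If \<open>nbrs G y\<close> is the smaller set, then \<open>u\<close>, and
        hence adjacency to \<open>w\<close>, carries over, and \<open>w\<close> is the common
        neighbour of \<open>u\<close> and \<open>w'\<close>; otherwise \<open>w'\<close> is adjacent
        to \<open>y\<close>, and \<open>y\<close> is.\<close>
      with ww' \<open>y \<in> nbrs G u\<close> nbrs_sym have "w \<in> nbrs G u \<or> y \<in> nbrs G w'" by blast
      with ww' \<open>y \<in> nbrs G u\<close> show ?thesis by blast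
    qed (use ww' in blast)
  qed
  moreover have "nbrs G u \<inter> nbrs G x = {}" if "x \<in> nbrs G v" for x
  proof -
    have "x \<in> Y" using that bipartition_nbrs(1)[OF bip assms(5)] by blast
    then have "nbrs G x \<subseteq> X" by (rule bipartition_nbrs(2)[OF bip])
    moreover have "nbrs G u \<subseteq> Y" by (rule bipartition_nbrs(1)[OF bip assms(4)])
    ultimately show ?thesis using bip unfolding bipartition_def by blast
  qed
  ultimately show ?thesis
    using nested by blast
qed simp

text \<open>
  Since the neighbourhoods in \<open>X\<close> are nested, \<open>x \<in> X\<close> and \<open>y \<in> Y\<close> are adjacent iff the degree of \<open>x\<close>
  is at least the least degree \<open>k y\<close> of a neighbour of \<open>y\<close>. Inserting \<open>t\<close> keeps \<open>Min\<close> away from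
  the empty set when \<open>y\<close> is isolated.
\<close>

lemma difference_graph_nested:
  assumes bip: "bipartition G X Y"
    and nested: "\<And>a b. a \<in> X \<Longrightarrow> b \<in> X \<Longrightarrow> nbrs G a \<subseteq> nbrs G b \<or> nbrs G b \<subseteq> nbrs G a"
  shows "difference_graph G"
proof -
  let ?d = "\<lambda>x. card (nbrs G x)"
  \<comment> \<open>Chosen larger than every degree.\<close>
  define t where "t = Suc (card (pverts G))"
  define k where "k = (\<lambda>y. Min (insert t (?d ` nbrs G y)))"
  \<comment> \<open>For \<open>x\<close> in \<open>X\<close> and \<open>y\<close> in
    \<open>Y\<close> the difference \<open>w x - w y\<close> is the degree of \<open>x\<close> plus
    \<open>t - k y\<close>, so it reaches \<open>t\<close> iff \<open>k y\<close> is at most that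
    degree. Weights lie in \<open>[0, t)\<close> on \<open>X\<close> and, as \<open>k y\<close> is
    positive, in \<open>(-t, 0]\<close> on \<open>Y\<close>; hence differences within a part stay
    below \<open>t\<close>.\<close>
  define w where "w = (\<lambda>v. if v \<in> X then real (?d v) else real (k v) - real t)"
  have V: "pverts G = X \<union> Y" "X \<inter> Y = {}"
    using bip by (auto simp: bipartition_def)
  have d: "?d x < t" for x
    unfolding t_def using card_mono[OF pair_finite_verts nbrs_subset] by (simp add: less_Suc_eq_le)
  have k_le: "k y \<le> t" for y
    unfolding k_def using finite_nbrs by (intro Min_le) auto
  have k_pos: "0 < k y" for y
  proof -
    have "0 < ?d x" if "x \<in> nbrs G y" for x
      using that nbrs_sym[of x y] finite_nbrs by (auto simp: card_gt_0_iff)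
    then show ?thesis
      unfolding k_def using finite_nbrs by (subst Min_gr_iff) (auto simp: t_def)
  qed
  have adj: "y \<in> nbrs G x \<longleftrightarrow> k y \<le> ?d x" if "x \<in> X" "y \<in> Y" for x y
  proof
    assume "y \<in> nbrs G x"
    then have "x \<in> nbrs G y" by (simp add: nbrs_sym)
    then show "k y \<le> ?d x"
      unfolding k_def using finite_nbrs by (intro Min_le) auto
  next
    assume "k y \<le> ?d x"
    \<comment> \<open>The default value \<open>t\<close> is excluded, so the minimum is attained at
      an actual neighbour \<open>x0\<close> of \<open>y\<close>.\<close>
    with d[of x] have "k y \<noteq> t" by simp
    moreover have "k y \<in> insert t (?d ` nbrs G y)"
      unfolding k_def using finite_nbrs by (intro Min_in) auto
    ultimately obtain x0 where x0: "x0 \<in> nbrs G y" "k y = ?d x0" by auto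
    then have "x0 \<in> X" using bipartition_nbrs(2)[OF bip that(2)] by blast
    \<comment> \<open>Even if nestedness gives the reverse inclusion, the degree of
      \<open>x0\<close> being at most that of \<open>x\<close> forces equality.\<close>
    then have "nbrs G x0 \<subseteq> nbrs G x"
      using nested[OF \<open>x0 \<in> X\<close> that(1)] card_seteq[OF finite_nbrs, of "nbrs G x" x0] \<open>k y \<le> ?d x\<close> x0
      by auto
    with x0 show "y \<in> nbrs G x" using nbrs_sym by blast
  qed
  have wX: "w x = real (?d x)" if "x \<in> X" for x using that by (simp add: w_def)
  have wY: "w y = real (k y) - real t" if "y \<in> Y" for y using that V by (auto simp: w_def)
  have "\<bar>w v\<bar> < real t" if "v \<in> pverts G" for v
    using d[of v] k_le[of v] k_pos[of v] by (auto simp: w_def)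
  moreover have "(u, v) \<in> parcs G \<longleftrightarrow> real t \<le> \<bar>w u - w v\<bar>"
    if uv: "u \<in> pverts G" "v \<in> pverts G" for u v
  proof -
    have cross: "real t \<le> \<bar>w x - w y\<bar> \<longleftrightarrow> y \<in> nbrs G x" if "x \<in> X" "y \<in> Y" for x y
      unfolding adj[OF that] wX[OF that(1)] wY[OF that(2)] using k_le[of y] by auto
    have X: "\<not> real t \<le> \<bar>w u - w v\<bar>" if "u \<in> X" "v \<in> X"
      using d[of u] d[of v] by (simp add: wX that)
    have Y: "\<not> real t \<le> \<bar>w u - w v\<bar>" if "u \<in> Y" "v \<in> Y"
      using k_le[of u] k_le[of v] k_pos[of u] k_pos[of v] by (simp add: wY that)
    show ?thesis
      using uv V X Y cross[of u v] cross[of v u] nbrs_sym[of u v]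
        bipartition_arc[OF bip, of u v] bipartition_disjoint[OF bip]
      unfolding nbrs_iff abs_minus_commute[of "w v"] by blast
  qed
  ultimately show ?thesis
    unfolding difference_graph_def by blast
qed

end

section \<open>Optimality forbids a proper compression\<close>

theorem theorem3p5:
  fixes n m :: nat and G :: "'a pair_pre_digraph"
  assumes "n > 0" and "m > 0"
    and "(bip_graphs n m :: 'a pair_pre_digraph set) \<noteq> {}"
    and "bipartite_optimal n m G"
  shows "difference_graph G"
proof -
  have G: "G \<in> bip_graphs n m"
    and opt: "\<And>H :: 'a pair_pre_digraph. H \<in> bip_graphs n m \<Longrightarrow> poly_coeff 4 G \<le> poly_coeff 4 H"
    using assms(4) unfolding bipartite_optimal_def by blast+
  then interpret pair_graph G
    by (simp add: bip_graphs_def)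
  have conn: "connected (with_proj G)"
    using G by (simp add: bip_graphs_def)
  \<comment> \<open>Stated for every bipartition, so that it serves both parts. A violation would
    make \<open>compress u v G\<close> a competitor with smaller a_4.\<close>
  have nested: "nbrs G u \<subseteq> nbrs G v \<or> nbrs G v \<subseteq> nbrs G u"
    if bip: "bipartition G X Y" and uv: "u \<in> X" "v \<in> X" and "nbrs G u \<inter> nbrs G v \<noteq> {}" for X Y u v
  proof (rule ccontr)
    assume inc: "\<not> ?thesis"
    then have "u \<noteq> v" by auto
    have "bipartite (compress u v G)"
      using bipartition_compress[OF bip uv] unfolding bipartition_def bipartite_def by blast
    with that(4) G have "compress u v G \<in> bip_graphs n m"
      using pair_graph_compress[OF bip uv] connected_compress[OF bip uv conn]
        card_uedges_compress[OF bip uv \<open>u \<noteq> v\<close>]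
      by (auto simp: bip_graphs_def)
    with opt[of "compress u v G"] poly_coeff_compress_less[OF bip uv] inc show False
      by (auto simp: not_le)
  qed
  obtain X Y where bip: "bipartition G X Y"
    using G by (auto simp: bip_graphs_def bipartite_def bipartition_def)
  have "nbrs G a \<subseteq> nbrs G b \<or> nbrs G b \<subseteq> nbrs G a" if ab: "nbrs G a \<inter> nbrs G b \<noteq> {}" for a b
  proof -
    \<comment> \<open>A common neighbour puts both vertices in the part opposite to it.\<close>
    from ab have "a \<in> X \<and> b \<in> X \<or> a \<in> Y \<and> b \<in> Y"
      using bip by (fastforce simp: bipartition_def nbrs_iff)
    then show ?thesis
      using nested[OF bip _ _ ab] nested[OF bipartition_commute[OF bip] _ _ ab] by blast
  qed
  from difference_graph_nested[OF bip nested_nbrs[OF bip conn this]] show ?thesis .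
qed

end
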